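(* For every graph $G$ (simple, finite, with at least one edge): (i) $\operatorname{dc}_1(G)=\chi_c(G)-1$; (ii) $\operatorname{pw}_1(G)=\chi(G)-1$; (iii) $\operatorname{re}_1(G)=\operatorname{bw}(G)$.
   Context: A one-dimensional representation of $G=(V,E)$ is a function $\rho:V\to\mathbb{R}$. It is non-edge-degenerate (NED) if $\rho(u)\ne\rho(v)$ for every edge $uv\in E$, and non-vertex-degenerate (NVD) if injective. $V_2(G)$ is the set of 2-element subsets of $V$. Define $\operatorname{dc}_1(G)=\min_\rho \frac{\max_{uv\in E}|\rho(u)-\rho(v)|}{\min_{uv\in E}|\rho(u)-\rho(v)|}$ over NED one-dimensional $\rho$; $\operatorname{pw}_1(G)=\min_\rho \frac{\max_{uv\in V_2(G)}|\rho(u)-\rho(v)|}{\min_{uv\in E}|\rho(u)-\rho(v)|}$ over NED one-dimensional $\rho$; $\operatorname{re}_1(G)=\min_\rho \frac{\max_{uv\in E}|\rho(u)-\rho(v)|}{\min_{uv\in V_2(G)}|\rho(u)-\rho(v)|}$ over NVD one-dimensional $\rho$. For $c\ge1$, a circular $c$-coloring of $G$ is a map $f:V\to[0,c)$ with $1\le|f(u)-f(v)|\le c-1$ for every edge $uv$; the circular chromatic number is $\chi_c(G)=\inf\{c: G\text{ admits a circular }c\text{-coloring}\}$. $\chi(G)$ is the chromatic number. With $n=|V|$, the bandwidth is $\operatorname{bw}(G)=\min_{\pi}\max_{uv\in E}|\pi(u)-\pi(v)|$ over bijections $\pi:V\to\{1,\dots,n\}$. *)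

theory Defs
  imports Complex_Main
begin

definition two_subsets :: "'a set \<Rightarrow> 'a set set" where
  "two_subsets V = {e. e \<subseteq> V \<and> card e = 2}"

definition simple_graph :: "'a set \<Rightarrow> 'a set set \<Rightarrow> bool" where
  "simple_graph V E \<longleftrightarrow> finite V \<and> E \<subseteq> two_subsets V"

(* Maps on the vertex set are total functions; only their values on V matter. *)

definition edge_lengths :: "('a \<Rightarrow> real) \<Rightarrow> 'a set set \<Rightarrow> real set" where
  "edge_lengths \<rho> F = {\<bar>\<rho> u - \<rho> v\<bar> | u v. {u, v} \<in> F}"

definition ned :: "'a set set \<Rightarrow> ('a \<Rightarrow> real) \<Rightarrow> bool" where
  "ned E \<rho> \<longleftrightarrow> (\<forall>u v. {u, v} \<in> E \<longrightarrow> \<rho> u \<noteq> \<rho> v)"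

definition nvd :: "'a set \<Rightarrow> ('a \<Rightarrow> real) \<Rightarrow> bool" where
  "nvd V \<rho> \<longleftrightarrow> inj_on \<rho> V"

definition dc_ratio :: "'a set set \<Rightarrow> ('a \<Rightarrow> real) \<Rightarrow> real" where
  "dc_ratio E \<rho> = Max (edge_lengths \<rho> E) / Min (edge_lengths \<rho> E)"

definition pw_ratio :: "'a set \<Rightarrow> 'a set set \<Rightarrow> ('a \<Rightarrow> real) \<Rightarrow> real" where
  "pw_ratio V E \<rho> = Max (edge_lengths \<rho> (two_subsets V)) / Min (edge_lengths \<rho> E)"

definition re_ratio :: "'a set \<Rightarrow> 'a set set \<Rightarrow> ('a \<Rightarrow> real) \<Rightarrow> real" where
  "re_ratio V E \<rho> = Max (edge_lengths \<rho> E) / Min (edge_lengths \<rho> (two_subsets V))"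

(* The next three are minima over infinite sets of reals: LEAST is unspecified
   unless the minimum is attained, so attainment has to be established separately. *)

definition dc1 :: "'a set set \<Rightarrow> real" where
  "dc1 E = (LEAST r. \<exists>\<rho>. ned E \<rho> \<and> r = dc_ratio E \<rho>)"

definition pw1 :: "'a set \<Rightarrow> 'a set set \<Rightarrow> real" where
  "pw1 V E = (LEAST r. \<exists>\<rho>. ned E \<rho> \<and> r = pw_ratio V E \<rho>)"

definition re1 :: "'a set \<Rightarrow> 'a set set \<Rightarrow> real" where
  "re1 V E = (LEAST r. \<exists>\<rho>. nvd V \<rho> \<and> r = re_ratio V E \<rho>)"

definition circular_coloring :: "'a set \<Rightarrow> 'a set set \<Rightarrow> real \<Rightarrow> ('a \<Rightarrow> real) \<Rightarrow> bool" where
  "circular_coloring V E c f \<longleftrightarrow>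
     f ` V \<subseteq> {0..<c} \<and>
     (\<forall>u v. {u, v} \<in> E \<longrightarrow> 1 \<le> \<bar>f u - f v\<bar> \<and> \<bar>f u - f v\<bar> \<le> c - 1)"

definition circular_chromatic_number :: "'a set \<Rightarrow> 'a set set \<Rightarrow> real" where
  "circular_chromatic_number V E = Inf {c. 1 \<le> c \<and> (\<exists>f. circular_coloring V E c f)}"

definition proper_coloring :: "'a set \<Rightarrow> 'a set set \<Rightarrow> nat \<Rightarrow> ('a \<Rightarrow> nat) \<Rightarrow> bool" where
  "proper_coloring V E k f \<longleftrightarrow>
     f ` V \<subseteq> {..<k} \<and> (\<forall>u v. {u, v} \<in> E \<longrightarrow> f u \<noteq> f v)"

definition chromatic_number :: "'a set \<Rightarrow> 'a set set \<Rightarrow> nat" where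
  "chromatic_number V E = (LEAST k. \<exists>f. proper_coloring V E k f)"

definition bandwidth :: "'a set \<Rightarrow> 'a set set \<Rightarrow> nat" where
  "bandwidth V E =
     (LEAST k. \<exists>\<pi> :: 'a \<Rightarrow> nat. bij_betw \<pi> V {1..card V} \<and>
        k = Max {nat \<bar>int (\<pi> u) - int (\<pi> v)\<bar> | u v. {u, v} \<in> E})"

end

theory Submission
  imports Defs
begin

text \<open>
  Scale a representation so that its shortest edge has length \<open>1\<close>. Reducing it modulo
  \<open>c = r + 1\<close>, where \<open>r\<close> is its longest edge, gives a circular \<open>c\<close>-colouring; taking floors
  gives a proper colouring; replacing values by ranks (when all pairs are at distance at least
  \<open>1\<close>) gives a vertex ordering that stretches no edge. Conversely, each of these objects is
  itself a representation of the required ratio. Attainment is automatic for the two integral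
  parameters; for the circular chromatic number it follows by compactness of a cube.
\<close>

section \<open>Minima, floors and convergent subsequences\<close>

text \<open>A witness \<open>x\<close> whose value is at most a lower bound \<open>b\<close> attains
  \<open>b\<close>. Each of the three equalities ends here, so one good representation and one
  universal bound settle both attainment and the value of the \<open>LEAST\<close>.\<close>

lemma arg_min_and_Least:
  fixes f :: "'b \<Rightarrow> real"
  assumes "P x" "f x \<le> b" "\<And>y. P y \<Longrightarrow> b \<le> f y"
  shows "(\<exists>x. is_arg_min f P x) \<and> (LEAST r. \<exists>x. P x \<and> r = f x) = b"
proof
  show "\<exists>x. is_arg_min f P x"
    using assms by (fastforce simp: is_arg_min_def)
  have "f x = b"
    using assms by (simp add: order_antisym)
  then show "(LEAST r. \<exists>x. P x \<and> r = f x) = b"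
    using assms by (intro Least_equality) auto
qed

lemma floor_neq_if_separated:
  fixes x y :: real
  assumes "1 \<le> \<bar>x - y\<bar>"
  shows "\<lfloor>x\<rfloor> \<noteq> \<lfloor>y\<rfloor>"
  using assms by linarith

text \<open>Bolzano-Weierstrass, one coordinate at a time: for each new vertex the subsequence is
  thinned to one that is monotone there, hence convergent by boundedness.\<close>

lemma convergent_subseq_finite:
  fixes f :: "nat \<Rightarrow> 'a \<Rightarrow> real"
  assumes "finite V" "\<And>n v. v \<in> V \<Longrightarrow> \<bar>f n v\<bar> \<le> B"
  shows "\<exists>s g. strict_mono s \<and> (\<forall>v\<in>V. (\<lambda>n. f (s n) v) \<longlonglongrightarrow> g v)"
  using assms
proof (induction V rule: finite_induct)
  case empty
  show ?case
    by (intro exI[of _ id]) (simp add: strict_mono_def)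
next
  case (insert w V)
  then obtain s g where s: "strict_mono s"
    and g: "\<forall>v\<in>V. (\<lambda>n. f (s n) v) \<longlonglongrightarrow> g v"
    by auto
  obtain t where t: "strict_mono t" and mono: "monoseq (\<lambda>n. f (s (t n)) w)"
    using seq_monosub[of "\<lambda>n. f (s n) w"] by auto
  have "Bseq (\<lambda>n. f (s (t n)) w)"
    using insert.prems by (intro BseqI'[of _ B]) auto
  with mono obtain l where l: "(\<lambda>n. f (s (t n)) w) \<longlonglongrightarrow> l"
    using Bseq_monoseq_convergent unfolding convergent_def by blast
  have "(\<lambda>n. f (s (t n)) v) \<longlonglongrightarrow> g v" if "v \<in> V" for v
    using LIMSEQ_subseq_LIMSEQ[OF g[rule_format, OF that] t] by (simp add: o_def)
  \<comment> \<open>As \<open>w\<close> lies outside \<open>V\<close>, overwriting \<open>g\<close>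
    at \<open>w\<close> keeps the earlier limits.\<close>
  with l have "\<forall>v\<in>insert w V. (\<lambda>n. f ((s \<circ> t) n) v) \<longlonglongrightarrow> (g(w := l)) v"
    using insert.hyps by auto
  then show ?case
    using strict_mono_o[OF s t] by blast
qed

section \<open>Edge lengths and their extrema\<close>

lemma finite_edge_lengths:
  assumes "finite V" "F \<subseteq> two_subsets V"
  shows "finite (edge_lengths \<rho> F)"
proof -
  have "edge_lengths \<rho> F \<subseteq> (\<lambda>(u, v). \<bar>\<rho> u - \<rho> v\<bar>) ` (V \<times> V)"
    using assms(2) unfolding edge_lengths_def two_subsets_def by force
  then show ?thesis
    using assms(1) by (meson finite_SigmaI finite_imageI finite_subset)
qed

lemma edge_lengths_nonempty:
  assumes "F \<subseteq> two_subsets V" "F \<noteq> {}"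
  shows "edge_lengths \<rho> F \<noteq> {}"
proof -
  obtain e where e: "e \<in> F" "card e = 2"
    using assms unfolding two_subsets_def by auto
  then obtain u v where "e = {u, v}"
    by (meson card_2_iff)
  with e show ?thesis
    unfolding edge_lengths_def by auto
qed

lemma edge_in_two_subsets:
  assumes "F \<subseteq> two_subsets V" "{u, v} \<in> F"
  shows "u \<in> V" "v \<in> V" "u \<noteq> v"
  using assms unfolding two_subsets_def by (auto simp: card_insert_if split: if_splits)

lemma pair_in_two_subsets: "u \<in> V \<Longrightarrow> v \<in> V \<Longrightarrow> u \<noteq> v \<Longrightarrow> {u, v} \<in> two_subsets V"
  unfolding two_subsets_def by auto

lemma edge_length_le_Max:
  assumes "finite V" "F \<subseteq> two_subsets V" "{u, v} \<in> F"
  shows "\<bar>\<rho> u - \<rho> v\<bar> \<le> Max (edge_lengths \<rho> F)"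
  using assms by (intro Max_ge finite_edge_lengths) (auto simp: edge_lengths_def)

lemma Min_le_edge_length:
  assumes "finite V" "F \<subseteq> two_subsets V" "{u, v} \<in> F"
  shows "Min (edge_lengths \<rho> F) \<le> \<bar>\<rho> u - \<rho> v\<bar>"
  using assms by (intro Min_le finite_edge_lengths) (auto simp: edge_lengths_def)

lemma Min_edge_lengths_pos:
  assumes "finite V" "F \<subseteq> two_subsets V" "F \<noteq> {}" "ned F \<rho>"
  shows "0 < Min (edge_lengths \<rho> F)"
  using assms(4) Min_in[OF finite_edge_lengths[OF assms(1,2)] edge_lengths_nonempty[OF assms(2,3)], of \<rho>]
  by (force simp: edge_lengths_def ned_def)

text \<open>Injective representations are the NED representations of the complete graph, so facts
  about \<open>ned\<close> also cover \<open>nvd\<close>.\<close>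

lemma ned_two_subsets_iff: "ned (two_subsets V) \<rho> \<longleftrightarrow> nvd V \<rho>"
  unfolding ned_def nvd_def inj_on_def
  using edge_in_two_subsets[OF order_refl, of _ _ V] pair_in_two_subsets[of _ V] by metis

lemma ned_mono: "ned F \<rho> \<Longrightarrow> F' \<subseteq> F \<Longrightarrow> ned F' \<rho>"
  unfolding ned_def by blast

text \<open>The upper bound shared by all three ratios: \<open>F\<close> supplies the numerator and
  \<open>F'\<close> the denominator, each being \<open>E\<close> or
  \<open>two_subsets V\<close>.\<close>

lemma Max_div_Min_le:
  assumes V: "finite V" "F \<subseteq> two_subsets V" "F \<noteq> {}" "F' \<subseteq> two_subsets V" "F' \<noteq> {}"
    and upper: "\<And>u v. {u, v} \<in> F \<Longrightarrow> \<bar>\<rho> u - \<rho> v\<bar> \<le> a"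
    and lower: "\<And>u v. {u, v} \<in> F' \<Longrightarrow> 1 \<le> \<bar>\<rho> u - \<rho> v\<bar>"
  shows "Max (edge_lengths \<rho> F) / Min (edge_lengths \<rho> F') \<le> a"
proof -
  have max: "Max (edge_lengths \<rho> F) \<le> a"
    using upper finite_edge_lengths[OF V(1,2)] edge_lengths_nonempty[OF V(2,3)]
    by (subst Max_le_iff) (auto simp: edge_lengths_def)
  have min: "1 \<le> Min (edge_lengths \<rho> F')"
    using lower finite_edge_lengths[OF V(1,4)] edge_lengths_nonempty[OF V(4,5)]
    by (subst Min_ge_iff) (auto simp: edge_lengths_def)
  \<comment> \<open>The number \<open>a\<close> bounds an absolute value, so it is nonnegative and
    dividing by a minimum of at least 1 cannot push the ratio above it.\<close>
  obtain l where "l \<in> edge_lengths \<rho> F"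
    using edge_lengths_nonempty[OF V(2,3)] by blast
  then have "0 \<le> a"
    using upper unfolding edge_lengths_def by fastforce
  then have "a \<le> a * Min (edge_lengths \<rho> F')"
    using min by (simp add: mult_le_cancel_left1)
  with max min show ?thesis
    by (simp add: divide_le_eq)
qed

section \<open>Reduction modulo \<open>c\<close> and the circular chromatic number\<close>

lemma real_mod_range:
  fixes t c :: real
  assumes "0 < c"
  shows "0 \<le> t - c * of_int \<lfloor>t / c\<rfloor> \<and> t - c * of_int \<lfloor>t / c\<rfloor> < c"
  using floor_divide_lower[OF assms, of t] floor_divide_upper[OF assms, of t]
  by (simp add: algebra_simps)

text \<open>Since \<open>x\<close> and \<open>y\<close> are less than \<open>c\<close> apart, their
  quotients by \<open>c\<close> have floors differing by at most 1. Reduction thus keeps the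
  distance \<open>d\<close> or turns it into \<open>c - d\<close>, and the interval
  \<open>[1, c - 1]\<close> is symmetric under this exchange.\<close>

lemma mod_circle_distance:
  fixes x y c :: real
  assumes "1 \<le> \<bar>x - y\<bar>" "\<bar>x - y\<bar> \<le> c - 1"
  defines "r \<equiv> \<lambda>t. t - c * of_int \<lfloor>t / c\<rfloor>"
  shows "1 \<le> \<bar>r x - r y\<bar>" "\<bar>r x - r y\<bar> \<le> c - 1"
proof -
  have c: "0 < c"
    using assms by linarith
  define k where "k = \<lfloor>x / c\<rfloor> - \<lfloor>y / c\<rfloor>"
  have "\<bar>x / c - y / c\<bar> < 1"
    using assms c by (simp flip: diff_divide_distrib)
  then have "k = -1 \<or> k = 0 \<or> k = 1"
    unfolding k_def by linarith
  then have "c * of_int k = - c \<or> c * of_int k = 0 \<or> c * of_int k = c"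
    by auto
  moreover have diff: "r x - r y = (x - y) - c * of_int k"
    unfolding r_def k_def by (simp add: algebra_simps)
  \<comment> \<open>If \<open>k\<close> is 1 or -1, residues in \<open>[0, c)\<close> force the sign
    of \<open>x - y\<close>, which makes the new distance
    \<open>c - \<bar>x - y\<bar>\<close>.\<close>
  moreover have range: "0 \<le> r t \<and> r t < c" for t
    unfolding r_def using c by (rule real_mod_range)
  ultimately show "1 \<le> \<bar>r x - r y\<bar>" "\<bar>r x - r y\<bar> \<le> c - 1"
    using assms(1,2) range[of x] range[of y] by linarith+
qed

text \<open>This yields the lower bound on \<open>dc_ratio\<close>. Nonnegativity is included
  because the infimum ranges only over \<open>c\<close> with \<open>1 \<le> c\<close>.\<close>

lemma circular_coloring_from_ned:
  assumes V: "finite V" "E \<subseteq> two_subsets V" "E \<noteq> {}" and "ned E \<rho>"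
  shows "0 \<le> dc_ratio E \<rho> \<and> (\<exists>f. circular_coloring V E (dc_ratio E \<rho> + 1) f)"
proof -
  define m where "m = Min (edge_lengths \<rho> E)"
  \<comment> \<open>With this \<open>c\<close>, the edge lengths scaled by \<open>m\<close> lie in
    \<open>[1, c - 1]\<close>, as reduction modulo \<open>c\<close> requires.\<close>
  define c where "c = dc_ratio E \<rho> + 1"
  define f where "f v = \<rho> v / m - c * of_int \<lfloor>\<rho> v / m / c\<rfloor>" for v
  have m: "0 < m"
    unfolding m_def using assms by (rule Min_edge_lengths_pos)
  have edge: "1 \<le> \<bar>\<rho> u / m - \<rho> v / m\<bar> \<and> \<bar>\<rho> u / m - \<rho> v / m\<bar> \<le> c - 1"
    if "{u, v} \<in> E" for u v
    using m Min_le_edge_length[OF V(1,2) that, of \<rho>] edge_length_le_Max[OF V(1,2) that, of \<rho>]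
    by (simp add: c_def dc_ratio_def m_def divide_right_mono flip: diff_divide_distrib)
  have "\<exists>l. l \<in> edge_lengths \<rho> E"
    using edge_lengths_nonempty[OF V(2,3)] by blast
  then obtain u v where "{u, v} \<in> E"
    unfolding edge_lengths_def by auto
  with edge have c: "1 \<le> c"
    by fastforce
  have "0 \<le> f v \<and> f v < c" for v
    unfolding f_def using c by (intro real_mod_range) simp
  then have "circular_coloring V E c f"
    unfolding circular_coloring_def f_def using edge mod_circle_distance by fastforce
  then show ?thesis
    using c unfolding c_def by auto
qed

lemma ned_exists:
  assumes "finite V" "E \<subseteq> two_subsets V"
  shows "\<exists>\<rho>. nvd V \<rho> \<and> ned E \<rho>"
proof -
  obtain h :: "'a \<Rightarrow> nat" where "inj_on h V"
    using finite_imp_inj_to_nat_seg[OF assms(1)] by auto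
  then have "nvd V (\<lambda>v. real (h v))"
    unfolding nvd_def inj_on_def by simp
  then show ?thesis
    using ned_mono[OF _ assms(2)] ned_two_subsets_iff by blast
qed

text \<open>Colorings whose parameters approach the infimum have a pointwise convergent subsequence.
  The edge inequalities are closed conditions, so they survive in the limit; the half-open range
  \<open>[0, c)\<close> need not, and \<open>g\<close> is used only as a representation.\<close>

lemma circular_chromatic_limit:
  assumes "finite V" "E \<subseteq> two_subsets V" "E \<noteq> {}"
  defines "x \<equiv> circular_chromatic_number V E"
  shows "\<exists>g. \<forall>u v. {u, v} \<in> E \<longrightarrow> 1 \<le> \<bar>g u - g v\<bar> \<and> \<bar>g u - g v\<bar> \<le> x - 1"
proof -
  let ?S = "{c. 1 \<le> c \<and> (\<exists>f. circular_coloring V E c f)}"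
  have bdd: "bdd_below ?S"
    by (intro bdd_belowI[of _ 1]) auto
  obtain \<rho> where "ned E \<rho>"
    using ned_exists[OF assms(1,2)] by blast
  from circular_coloring_from_ned[OF assms(1-3) this] have ne: "?S \<noteq> {}"
    by (auto intro!: exI[of _ "dc_ratio E \<rho> + 1"])
  \<comment> \<open>Pairing the parameter with its coloring lets a single choice produce both
    sequences.\<close>
  have "\<exists>p. fst p < x + 1 / real (Suc n) \<and> circular_coloring V E (fst p) (snd p)" for n
  proof -
    have "Inf ?S < x + 1 / real (Suc n)"
      unfolding x_def circular_chromatic_number_def by simp
    then obtain c f where "c < x + 1 / real (Suc n)" "circular_coloring V E c f"
      unfolding cInf_less_iff[OF ne bdd] by blast
    then show ?thesis
      by (intro exI[of _ "(c, f)"]) simp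
  qed
  then obtain p where p: "\<And>n. fst (p n) < x + 1 / real (Suc n) \<and> circular_coloring V E (fst (p n)) (snd (p n))"
    using choice[of "\<lambda>n p. fst p < x + 1 / real (Suc n) \<and> circular_coloring V E (fst p) (snd p)"]
    by blast
  define c where "c n = fst (p n)" for n
  define f where "f n = snd (p n)" for n
  have c: "c n < x + 1 / real (Suc n)" and f: "circular_coloring V E (c n) (f n)" for n
    using p[of n] unfolding c_def f_def by simp_all
  \<comment> \<open>A bound uniform in \<open>n\<close> and \<open>v\<close>: values lie in
    \<open>[0, c n)\<close>, and the slack \<open>1 / real (Suc n)\<close> is at most 1.\<close>
  have "\<bar>f n v\<bar> \<le> x + 1" if "v \<in> V" for n v
  proof -
    have "0 \<le> f n v" "f n v < c n"
      using f[of n] that unfolding circular_coloring_def by auto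
    moreover have "1 / real (Suc n) \<le> 1"
      by simp
    ultimately show ?thesis
      using c[of n] by linarith
  qed
  then obtain s g where s: "strict_mono s" and g: "\<forall>v\<in>V. (\<lambda>n. f (s n) v) \<longlonglongrightarrow> g v"
    using convergent_subseq_finite[OF assms(1), of f "x + 1"] by blast
  have "1 \<le> \<bar>g u - g v\<bar> \<and> \<bar>g u - g v\<bar> \<le> x - 1" if e: "{u, v} \<in> E" for u v
  proof
    have lim: "(\<lambda>n. \<bar>f (s n) u - f (s n) v\<bar>) \<longlonglongrightarrow> \<bar>g u - g v\<bar>"
      using edge_in_two_subsets[OF assms(2) e] by (intro tendsto_intros g[rule_format])
    have bounds: "1 \<le> \<bar>f n u - f n v\<bar>" "\<bar>f n u - f n v\<bar> \<le> x + 1 / real (Suc n) - 1" for n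
      using f[of n] c[of n] e unfolding circular_coloring_def by force+
    show "1 \<le> \<bar>g u - g v\<bar>"
      using bounds by (intro LIMSEQ_le_const[OF lim]) auto
    have "(\<lambda>n. 1 / real (Suc (s n))) \<longlonglongrightarrow> 0"
      using LIMSEQ_subseq_LIMSEQ[OF LIMSEQ_inverse_real_of_nat s]
      by (simp add: o_def inverse_eq_divide)
    then have "(\<lambda>n. x + 1 / real (Suc (s n)) - 1) \<longlonglongrightarrow> x + 0 - 1"
      by (intro tendsto_intros)
    then show "\<bar>g u - g v\<bar> \<le> x - 1"
      using bounds LIMSEQ_le[OF lim] by fastforce
  qed
  then show ?thesis
    by blast
qed

lemma dc1_eq_circular_chromatic_number:
  assumes "finite V" "E \<subseteq> two_subsets V" "E \<noteq> {}"
  shows "(\<exists>\<rho>. is_arg_min (dc_ratio E) (ned E) \<rho>) \<and> dc1 E = circular_chromatic_number V E - 1"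
proof -
  obtain g where g: "\<And>u v. {u, v} \<in> E \<Longrightarrow>
      1 \<le> \<bar>g u - g v\<bar> \<and> \<bar>g u - g v\<bar> \<le> circular_chromatic_number V E - 1"
    using circular_chromatic_limit[OF assms] by blast
  have "ned E g"
    unfolding ned_def using g by fastforce
  moreover have "dc_ratio E g \<le> circular_chromatic_number V E - 1"
    unfolding dc_ratio_def using assms g by (intro Max_div_Min_le) auto
  moreover have "circular_chromatic_number V E - 1 \<le> dc_ratio E \<rho>" if "ned E \<rho>" for \<rho>
  proof -
    have "circular_chromatic_number V E \<le> dc_ratio E \<rho> + 1"
      unfolding circular_chromatic_number_def
      using circular_coloring_from_ned[OF assms that]
      by (intro cInf_lower bdd_belowI[of _ 1]) auto
    then show ?thesis
      by simp
  qed
  ultimately show ?thesis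
    unfolding dc1_def by (rule arg_min_and_Least[where P = "ned E" and f = "dc_ratio E"])
qed

section \<open>Floors and the chromatic number\<close>

text \<open>After shifting the least value to 0 and scaling the shortest edge to 1, all values lie
  between 0 and \<open>pw_ratio V E \<rho>\<close>, while adjacent values have different floors. The
  floors serve as colors; the extra 1 counts color 0.\<close>

lemma proper_coloring_from_ned:
  assumes V: "finite V" "E \<subseteq> two_subsets V" "E \<noteq> {}" and "ned E \<rho>"
  shows "0 \<le> pw_ratio V E \<rho> \<and> (\<exists>f. proper_coloring V E (nat \<lfloor>pw_ratio V E \<rho>\<rfloor> + 1) f)"
proof -
  define m where "m = Min (edge_lengths \<rho> E)"
  define a where "a = Min (\<rho> ` V)"
  define f where "f v = nat \<lfloor>(\<rho> v - a) / m\<rfloor>" for v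
  have m: "0 < m"
    unfolding m_def using assms by (rule Min_edge_lengths_pos)
  have "V \<noteq> {}"
    using V unfolding two_subsets_def by auto
  then have "a \<in> \<rho> ` V"
    using V(1) unfolding a_def by (intro Min_in) auto
  then obtain w where w: "w \<in> V" "\<rho> w = a"
    by blast
  have a: "a \<le> \<rho> v" if "v \<in> V" for v
    using V(1) that unfolding a_def by auto
  \<comment> \<open>The pair must be genuine to count in the maximum; \<open>v = w\<close> is
    handled later through \<open>nonneg\<close>.\<close>
  have max: "\<rho> v - a \<le> Max (edge_lengths \<rho> (two_subsets V))" if "v \<in> V" "v \<noteq> w" for v
    using edge_length_le_Max[OF V(1) order_refl pair_in_two_subsets, of v w \<rho>] w that by simp
  have "two_subsets V \<noteq> {}"
    using V by auto
  then obtain l where "l \<in> edge_lengths \<rho> (two_subsets V)"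
    using edge_lengths_nonempty[OF order_refl] by blast
  then have "0 \<le> l \<and> l \<le> Max (edge_lengths \<rho> (two_subsets V))"
    using finite_edge_lengths[OF V(1) order_refl, of \<rho>] by (auto simp: edge_lengths_def)
  then have nonneg: "0 \<le> Max (edge_lengths \<rho> (two_subsets V))"
    by linarith
  have "(\<rho> v - a) / m \<le> pw_ratio V E \<rho>" if "v \<in> V" for v
    unfolding pw_ratio_def m_def[symmetric]
    using max[OF that] nonneg w m by (cases "v = w") (auto intro!: divide_right_mono)
  then have "f v < nat \<lfloor>pw_ratio V E \<rho>\<rfloor> + 1" if "v \<in> V" for v
    unfolding f_def using that by (simp add: less_Suc_eq_le floor_mono nat_mono)
  moreover have "f u \<noteq> f v" if e: "{u, v} \<in> E" for u v
  proof -
    note uv = edge_in_two_subsets[OF V(2) e]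
    have "1 \<le> \<bar>(\<rho> u - a) / m - (\<rho> v - a) / m\<bar>"
      using m Min_le_edge_length[OF V(1,2) e, of \<rho>]
      by (simp add: m_def flip: diff_divide_distrib)
    then have "\<lfloor>(\<rho> u - a) / m\<rfloor> \<noteq> \<lfloor>(\<rho> v - a) / m\<rfloor>"
      by (rule floor_neq_if_separated)
    \<comment> \<open>Different floors stay different under \<open>nat\<close> only because neither
      is negative.\<close>
    moreover have "0 \<le> \<lfloor>(\<rho> u - a) / m\<rfloor>" "0 \<le> \<lfloor>(\<rho> v - a) / m\<rfloor>"
      using a uv m by simp_all
    ultimately show ?thesis
      unfolding f_def by (simp add: eq_nat_nat_iff)
  qed
  ultimately have "proper_coloring V E (nat \<lfloor>pw_ratio V E \<rho>\<rfloor> + 1) f"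
    unfolding proper_coloring_def by auto
  then show ?thesis
    using nonneg m unfolding pw_ratio_def m_def by auto
qed

text \<open>An optimal coloring by 0, ..., \<open>?k - 1\<close> is a representation of spread at
  most \<open>?k - 1\<close> with edges of length at least 1.\<close>

lemma pw1_eq_chromatic_number:
  assumes "finite V" "E \<subseteq> two_subsets V" "E \<noteq> {}"
  shows "(\<exists>\<rho>. is_arg_min (pw_ratio V E) (ned E) \<rho>) \<and> pw1 V E = real (chromatic_number V E) - 1"
proof -
  let ?k = "chromatic_number V E"
  obtain \<rho> where "ned E \<rho>"
    using ned_exists[OF assms(1,2)] by blast
  then have "\<exists>k f. proper_coloring V E k f"
    using proper_coloring_from_ned[OF assms] by blast
  then have "\<exists>f. proper_coloring V E ?k f"
    unfolding chromatic_number_def by (rule LeastI_ex)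
  then obtain f where f: "proper_coloring V E ?k f"
    by blast
  have "ned E (\<lambda>v. real (f v))"
    using f unfolding proper_coloring_def ned_def by auto
  moreover have "pw_ratio V E (\<lambda>v. real (f v)) \<le> real ?k - 1"
    unfolding pw_ratio_def
  proof (rule Max_div_Min_le[OF assms(1) order_refl _ assms(2,3)])
    show "two_subsets V \<noteq> {}"
      using assms by auto
    show "\<bar>real (f u) - real (f v)\<bar> \<le> real ?k - 1" if "{u, v} \<in> two_subsets V" for u v
    proof -
      have "f u < ?k" "f v < ?k"
        using f edge_in_two_subsets[OF order_refl that] unfolding proper_coloring_def by auto
      then show ?thesis
        by linarith
    qed
    show "1 \<le> \<bar>real (f u) - real (f v)\<bar>" if "{u, v} \<in> E" for u v
    proof -
      have "f u \<noteq> f v"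
        using f that unfolding proper_coloring_def by blast
      then show ?thesis
        by linarith
    qed
  qed
  moreover have "real ?k - 1 \<le> pw_ratio V E \<rho>" if "ned E \<rho>" for \<rho>
  proof -
    have "?k \<le> nat \<lfloor>pw_ratio V E \<rho>\<rfloor> + 1"
      unfolding chromatic_number_def
      using proper_coloring_from_ned[OF assms that] by (intro Least_le) blast
    moreover have "0 \<le> pw_ratio V E \<rho>"
      using proper_coloring_from_ned[OF assms that] by blast
    ultimately show ?thesis
      by linarith
  qed
  ultimately show ?thesis
    unfolding pw1_def by (rule arg_min_and_Least[where P = "ned E" and f = "pw_ratio V E"])
qed

section \<open>Ranks and bandwidth\<close>

text \<open>Each vertex counts itself, so ranks start at 1 and increase strictly with
  \<open>\<rho>\<close>. Injectivity and equal cardinalities then give surjectivity.\<close>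

lemma rank_bij_betw:
  fixes \<rho> :: "'a \<Rightarrow> 'b::linorder"
  assumes "finite V" "inj_on \<rho> V"
  shows "bij_betw (\<lambda>v. card {w\<in>V. \<rho> w \<le> \<rho> v}) V {1..card V}"
proof -
  let ?\<pi> = "\<lambda>v. card {w\<in>V. \<rho> w \<le> \<rho> v}"
  have less: "?\<pi> u < ?\<pi> v" if "v \<in> V" "\<rho> u < \<rho> v" for u v
  proof (intro psubset_card_mono psubsetI)
    have "v \<in> {w\<in>V. \<rho> w \<le> \<rho> v}" "v \<notin> {w\<in>V. \<rho> w \<le> \<rho> u}"
      using that by auto
    then show "{w\<in>V. \<rho> w \<le> \<rho> u} \<noteq> {w\<in>V. \<rho> w \<le> \<rho> v}"
      by blast
  qed (use assms(1) that in auto)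
  have inj: "inj_on ?\<pi> V"
  proof (rule inj_onI)
    fix u v assume uv: "u \<in> V" "v \<in> V" "?\<pi> u = ?\<pi> v"
    then have "\<rho> u = \<rho> v"
      using less[of v u] less[of u v] by (cases "\<rho> u" "\<rho> v" rule: linorder_cases) simp_all
    then show "u = v"
      using uv(1,2) by (rule inj_onD[OF assms(2)])
  qed
  have "?\<pi> ` V \<subseteq> {1..card V}"
  proof (rule image_subsetI)
    fix v assume "v \<in> V"
    then have "{w\<in>V. \<rho> w \<le> \<rho> v} \<noteq> {}"
      by blast
    then have "0 < ?\<pi> v"
      using assms(1) by (simp add: card_gt_0_iff)
    moreover have "?\<pi> v \<le> card V"
      using assms(1) by (intro card_mono) auto
    ultimately show "?\<pi> v \<in> {1..card V}"
      by simp
  qed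
  then have "?\<pi> ` V = {1..card V}"
    by (rule card_subset_eq[rotated]) (simp_all only: card_image[OF inj] card_atLeastAtMost finite_atLeastAtMost diff_Suc_1 One_nat_def)
  with inj show ?thesis
    unfolding bij_betw_def by blast
qed

text \<open>Taking floors of the scaled distances to \<open>\<rho> u\<close> embeds the vertices lying between
  \<open>u\<close> and \<open>v\<close> into an integer interval.\<close>

lemma rank_diff_le:
  fixes \<rho> :: "'a \<Rightarrow> real"
  assumes "finite V" "0 < m" "\<rho> u \<le> \<rho> v"
    and sep: "\<And>x y. x \<in> V \<Longrightarrow> y \<in> V \<Longrightarrow> x \<noteq> y \<Longrightarrow> m \<le> \<bar>\<rho> x - \<rho> y\<bar>" and "u \<in> V"
  shows "real (card {w\<in>V. \<rho> w \<le> \<rho> v}) - real (card {w\<in>V. \<rho> w \<le> \<rho> u}) \<le> (\<rho> v - \<rho> u) / m"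
proof -
  \<comment> \<open>Open at \<open>\<rho> u\<close> and closed at \<open>\<rho> v\<close>, so that
    \<open>card ?A\<close> is exactly the difference of the ranks.\<close>
  let ?A = "{w\<in>V. \<rho> u < \<rho> w \<and> \<rho> w \<le> \<rho> v}"
  let ?f = "\<lambda>w. \<lfloor>(\<rho> w - \<rho> u) / m\<rfloor>"
  have "{w\<in>V. \<rho> w \<le> \<rho> v} = {w\<in>V. \<rho> w \<le> \<rho> u} \<union> ?A"
    using assms(3) by auto
  then have card: "card {w\<in>V. \<rho> w \<le> \<rho> v} = card {w\<in>V. \<rho> w \<le> \<rho> u} + card ?A"
    using assms(1) by (simp add: card_Un_disjoint disjoint_iff)
  have "inj_on ?f ?A"
  proof (rule inj_onI, rule ccontr)
    fix x y assume xy: "x \<in> ?A" "y \<in> ?A" "?f x = ?f y" "x \<noteq> y"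
    then have "1 \<le> \<bar>(\<rho> x - \<rho> u) / m - (\<rho> y - \<rho> u) / m\<bar>"
      using sep[of x y] assms(2) by (simp flip: diff_divide_distrib)
    then show False
      using floor_neq_if_separated xy(3) by blast
  qed
  moreover have "?f ` ?A \<subseteq> {1..?f v}"
  proof
    fix z assume "z \<in> ?f ` ?A"
    then obtain w where w: "w \<in> ?A" "z = ?f w"
      by blast
    \<comment> \<open>Separation from \<open>u\<close> itself makes the floors start at 1 rather
      than 0, which saves the one unit that would spoil the bound.\<close>
    then have "m \<le> \<rho> w - \<rho> u"
      using sep[of w u] assms(5) by fastforce
    then have "1 \<le> (\<rho> w - \<rho> u) / m"
      using assms(2) by simp
    moreover have "(\<rho> w - \<rho> u) / m \<le> (\<rho> v - \<rho> u) / m"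
      using w assms(2) by (simp add: divide_right_mono)
    ultimately show "z \<in> {1..?f v}"
      using w by (simp add: floor_mono)
  qed
  ultimately have "card ?A \<le> nat (?f v)"
    using card_inj_on_le[of ?f ?A "{1..?f v}"] by simp
  moreover have "0 \<le> (\<rho> v - \<rho> u) / m"
    using assms(2,3) by simp
  ultimately show ?thesis
    unfolding card of_nat_add by linarith
qed

text \<open>The gaps in \<open>bandwidth\<close> are the image under \<open>nat\<close> and floor of
  the edge lengths of the labelling read as reals, so \<open>Max\<close> is taken over a finite
  nonempty set.\<close>

lemma finite_label_gaps:
  fixes \<pi> :: "'a \<Rightarrow> nat"
  assumes "finite V" "E \<subseteq> two_subsets V" "E \<noteq> {}"
  defines "D \<equiv> {nat \<bar>int (\<pi> u) - int (\<pi> v)\<bar> | u v. {u, v} \<in> E}"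
  shows "finite D" "D \<noteq> {}"
proof -
  have "nat \<bar>int a - int b\<bar> = nat \<lfloor>\<bar>real a - real b\<bar>\<rfloor>" for a b
    by linarith
  then have "D = {nat \<lfloor>\<bar>real (\<pi> u) - real (\<pi> v)\<bar>\<rfloor> | u v. {u, v} \<in> E}"
    unfolding D_def by simp
  also have "\<dots> = (\<lambda>x. nat \<lfloor>x\<rfloor>) ` edge_lengths (\<lambda>v. real (\<pi> v)) E"
    unfolding edge_lengths_def by blast
  finally have "D = (\<lambda>x. nat \<lfloor>x\<rfloor>) ` edge_lengths (\<lambda>v. real (\<pi> v)) E" .
  then show "finite D" "D \<noteq> {}"
    using finite_edge_lengths[OF assms(1,2)] edge_lengths_nonempty[OF assms(2,3)] by simp_all
qed

lemma re1_eq_bandwidth: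
  fixes V :: "'a set"
  assumes "finite V" "E \<subseteq> two_subsets V" "E \<noteq> {}"
  shows "(\<exists>\<rho>. is_arg_min (re_ratio V E) (nvd V) \<rho>) \<and> re1 V E = real (bandwidth V E)"
proof -
  let ?D = "\<lambda>\<pi> :: 'a \<Rightarrow> nat. {nat \<bar>int (\<pi> u) - int (\<pi> v)\<bar> | u v. {u, v} \<in> E}"
  let ?P = "\<lambda>k. \<exists>\<pi> :: 'a \<Rightarrow> nat. bij_betw \<pi> V {1..card V} \<and> k = Max (?D \<pi>)"
  have V2: "two_subsets V \<noteq> {}"
    using assms by auto
  obtain \<rho>0 where "nvd V \<rho>0"
    using ned_exists[OF assms(1,2)] by blast
  \<comment> \<open>Ranking any injective representation supplies an ordering, hence the
    \<open>LEAST\<close> in \<open>bandwidth\<close> is attained.\<close>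
  then have "\<exists>k. ?P k"
    using rank_bij_betw[OF assms(1)] unfolding nvd_def by blast
  then have "?P (bandwidth V E)"
    unfolding bandwidth_def by (rule LeastI_ex)
  then obtain \<pi> where \<pi>: "bij_betw \<pi> V {1..card V}" "bandwidth V E = Max (?D \<pi>)"
    by blast
  then have inj: "inj_on \<pi> V"
    by (simp add: bij_betw_def)
  have "nvd V (\<lambda>v. real (\<pi> v))"
    using inj unfolding nvd_def inj_on_def by simp
  moreover have "re_ratio V E (\<lambda>v. real (\<pi> v)) \<le> real (bandwidth V E)"
    unfolding re_ratio_def
  proof (rule Max_div_Min_le[OF assms order_refl V2])
    show "\<bar>real (\<pi> u) - real (\<pi> v)\<bar> \<le> real (bandwidth V E)" if "{u, v} \<in> E" for u v
    proof -
      have "nat \<bar>int (\<pi> u) - int (\<pi> v)\<bar> \<le> Max (?D \<pi>)"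
        using that by (intro Max_ge finite_label_gaps[OF assms]) blast
      then show ?thesis
        unfolding \<pi>(2) by linarith
    qed
    show "1 \<le> \<bar>real (\<pi> u) - real (\<pi> v)\<bar>" if "{u, v} \<in> two_subsets V" for u v
    proof -
      have "\<pi> u \<noteq> \<pi> v"
        using inj edge_in_two_subsets[OF order_refl that] by (simp add: inj_on_eq_iff)
      then show ?thesis
        by linarith
    qed
  qed
  moreover have "real (bandwidth V E) \<le> re_ratio V E \<rho>" if "nvd V \<rho>" for \<rho>
  proof -
    define m where "m = Min (edge_lengths \<rho> (two_subsets V))"
    define \<sigma> where "\<sigma> v = card {w\<in>V. \<rho> w \<le> \<rho> v}" for v
    have m: "0 < m"
      unfolding m_def using assms(1) V2 that
      by (intro Min_edge_lengths_pos) (auto simp: ned_two_subsets_iff)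
    have sep: "m \<le> \<bar>\<rho> x - \<rho> y\<bar>" if "x \<in> V" "y \<in> V" "x \<noteq> y" for x y
      unfolding m_def using assms(1) that
      by (intro Min_le_edge_length[OF _ order_refl] pair_in_two_subsets)
    \<comment> \<open>Ranking never lengthens a distance measured in units of \<open>m\<close>;
      orienting the pair costs nothing, since \<open>bound\<close> applies this both ways.\<close>
    have stretch: "\<bar>real (\<sigma> u) - real (\<sigma> v)\<bar> \<le> \<bar>\<rho> u - \<rho> v\<bar> / m"
      if "u \<in> V" "v \<in> V" "\<rho> u \<le> \<rho> v" for u v
    proof -
      have "\<sigma> u \<le> \<sigma> v"
        unfolding \<sigma>_def using assms(1) that by (intro card_mono) auto
      moreover have "real (\<sigma> v) - real (\<sigma> u) \<le> (\<rho> v - \<rho> u) / m"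
        unfolding \<sigma>_def using assms(1) m that(3) sep that(1) by (rule rank_diff_le)
      ultimately show ?thesis
        using that(3) by simp
    qed
    have bound: "\<bar>real (\<sigma> u) - real (\<sigma> v)\<bar> \<le> re_ratio V E \<rho>" if e: "{u, v} \<in> E" for u v
    proof -
      have "\<bar>real (\<sigma> u) - real (\<sigma> v)\<bar> \<le> \<bar>\<rho> u - \<rho> v\<bar> / m"
        using stretch[of u v] stretch[of v u] edge_in_two_subsets[OF assms(2) e]
        by (cases "\<rho> u \<le> \<rho> v") (simp_all add: abs_minus_commute)
      also have "\<dots> \<le> re_ratio V E \<rho>"
        unfolding re_ratio_def m_def[symmetric]
        using m edge_length_le_Max[OF assms(1,2) e] by (simp add: divide_right_mono)
      finally show ?thesis .
    qed
    have "bij_betw \<sigma> V {1..card V}"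
      unfolding \<sigma>_def using assms(1) that[unfolded nvd_def] by (rule rank_bij_betw)
    then have "bandwidth V E \<le> Max (?D \<sigma>)"
      unfolding bandwidth_def by (intro Least_le exI[of _ \<sigma>] conjI refl)
    \<comment> \<open>The maximal gap occurs at an actual edge, where \<open>bound\<close>
      applies.\<close>
    moreover have "Max (?D \<sigma>) \<in> ?D \<sigma>"
      by (intro Max_in finite_label_gaps[OF assms])
    then obtain u v where "{u, v} \<in> E" and max: "Max (?D \<sigma>) = nat \<bar>int (\<sigma> u) - int (\<sigma> v)\<bar>"
      by blast
    then have "real (Max (?D \<sigma>)) \<le> re_ratio V E \<rho>"
      using bound[of u v] unfolding max by linarith
    ultimately show ?thesis
      by linarith
  qed
  ultimately show ?thesis
    unfolding re1_def by (rule arg_min_and_Least[where P = "nvd V" and f = "re_ratio V E"])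
qed

theorem theorem6:
  fixes V :: "'a set" and E :: "'a set set"
  assumes "simple_graph V E" and "E \<noteq> {}"
  shows "((\<exists>\<rho>. is_arg_min (dc_ratio E) (ned E) \<rho>)
            \<and> dc1 E = circular_chromatic_number V E - 1)
       \<and> ((\<exists>\<rho>. is_arg_min (pw_ratio V E) (ned E) \<rho>)
            \<and> pw1 V E = real (chromatic_number V E) - 1)
       \<and> ((\<exists>\<rho>. is_arg_min (re_ratio V E) (nvd V) \<rho>)
            \<and> re1 V E = real (bandwidth V E))"
proof -
  have "finite V" "E \<subseteq> two_subsets V"
    using assms(1) unfolding simple_graph_def by auto
  note graph = this assms(2)
  show ?thesis
    by (intro conjI dc1_eq_circular_chromatic_number[OF graph, THEN conjunct1]
        dc1_eq_circular_chromatic_number[OF graph, THEN conjunct2]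
        pw1_eq_chromatic_number[OF graph, THEN conjunct1]
        pw1_eq_chromatic_number[OF graph, THEN conjunct2]
        re1_eq_bandwidth[OF graph, THEN conjunct1]
        re1_eq_bandwidth[OF graph, THEN conjunct2])
qed

end
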